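(* For $n\in\mathbb{N}$, let $s\in\{0,1\}^n$ be uniformly random and let $g:\{0,1\}^{2n}\to\{0,1\}^n$ be the random function with $g(x\Vert s)=x$ for all $x\in\{0,1\}^n$, and with all other values independent and uniformly random. Let $h:\{0,1\}^{2n}\to\{0,1\}^n$ be a uniformly random function. Let $\mathsf{C}$ be the construction with $\mathsf{C}^{\mathrm{pub}}=\mathsf{C}^{\mathrm{priv}}=O_g$ (an oracle for $g$), and let $\mathsf{R}$ be the construction with $\mathsf{R}^{\mathrm{pub}}=\mathsf{R}^{\mathrm{priv}}=O_h$ (an oracle for $h$). Then $\mathsf{C}$ is $(T,\epsilon)$ strong quantum statistical reset indifferentiable from $\mathsf{R}$ for some $\epsilon=O(T^2/2^n)$.
   Context: $\Vert$ denotes concatenation. A construction consists of a public interface (an oracle) and a private interface which is an algorithm with access to the public interface; here the private interface simply forwards to the public one. $(T,\epsilon)$ strong quantum statistical reset indifferentiability of $\mathsf{C}$ from $\mathsf{R}$: there exists an efficient simulator $\mathcal{S}$, independent of the distinguisher ("strong") and keeping no state between queries ("reset"), such that for every computationally unbounded quantum distinguisher $\mathcal{D}$ with one output bit that makes at most $T$ quantum queries in total to its two oracles ("quantum statistical"), $$\Big|\Pr\big[\mathcal{D}[\mathsf{C}^{\mathrm{priv}}[\mathsf{C}^{\mathrm{pub}}],\mathsf{C}^{\mathrm{pub}}]=1\big]-\Pr\big[\mathcal{D}[\mathsf{R}^{\mathrm{priv}},\mathcal{S}[\mathsf{R}^{\mathrm{pub}}]]=1\big]\Big|\le\epsilon .$$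 Here $\mathcal{S}$ has oracle access to $\mathsf{R}^{\mathrm{pub}}$ and answers the queries that $\mathcal{D}$ makes to the public interface. A quantum query to a function $F$ applies $|x\rangle|y\rangle\mapsto|x\rangle|y\oplus F(x)\rangle$. Probabilities are over $g$, $h$ and the algorithms' randomness. The constant in $O(T^2/2^n)$ is absolute. *)

theory Defs
  imports "HOL-Probability.Probability" "HOL-Probability.Product_PMF"
begin

section \<open>Bit strings and random functions\<close>

text \<open>The set of bit strings of length n is represented by lists; concatenation is \<open>@\<close>.\<close>

definition bits :: "nat \<Rightarrow> bool list set" where
  "bits n = {xs. length xs = n}"

type_synonym bfun = "bool list \<Rightarrow> bool list"

text \<open>Functions from 2n bits to n bits; they take the irrelevant default value \<open>[]\<close> on lists of
  any other length.\<close>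

definition uniform_fun :: "nat \<Rightarrow> bfun pmf" where
  "uniform_fun n = pmf_of_set (PiE_dflt (bits (2 * n)) [] (\<lambda>_. bits n))"

definition planted_fun :: "nat \<Rightarrow> bfun pmf" where
  "planted_fun n =
     bind_pmf (pmf_of_set (bits n)) (\<lambda>s.
       Pi_pmf (bits (2 * n)) []
         (\<lambda>z. if drop n z = s then return_pmf (take n z) else pmf_of_set (bits n)))"


section \<open>Oracle circuits\<close>

text \<open>
  Wires are numbered from 0. At parameter n, the first 3n wires carry a query, 2n wires for the
  input x followed by n wires for the response register y; all further wires are ancillas.
  \<open>Query k\<close> calls the oracle on the block of 3n wires starting at wire k. Hadamard, T and
  controlled-not form a universal gate set.
\<close>

datatype gate = Hadamard nat | PhaseT nat | CNot nat nat | Query nat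

type_synonym circuit = "gate list"

fun wf_gate :: "gate \<Rightarrow> bool" where
  "wf_gate (CNot i j) = (i \<noteq> j)"
| "wf_gate _ = True"

fun wires :: "nat \<Rightarrow> gate \<Rightarrow> nat" where
  "wires n (Hadamard i) = i + 1"
| "wires n (PhaseT i) = i + 1"
| "wires n (CNot i j) = max (i + 1) (j + 1)"
| "wires n (Query k) = k + 3 * n"

definition width :: "nat \<Rightarrow> circuit \<Rightarrow> nat" where
  "width n gs = foldr (\<lambda>g. max (wires n g)) gs (3 * n)"

text \<open>The label of the basis state to which a query to f on the wires starting at k sends the
  basis state q, that is, x, y becomes x, y xor f x on that block.\<close>

definition xor_query :: "nat \<Rightarrow> bfun \<Rightarrow> nat \<Rightarrow> bool list \<Rightarrow> bool list" where
  "xor_query n f k q =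
     take (k + 2 * n) q
     @ map2 (\<noteq>) (take n (drop (k + 2 * n) q)) (f (take (2 * n) (drop k q)))
     @ drop (k + 3 * n) q"

text \<open>
  Action on state vectors, given by their amplitudes in the computational basis. \<open>CNot\<close> and
  \<open>Query\<close> permute the basis states by an involution, so the amplitude of q afterwards is the
  previous amplitude of the image of q.
\<close>

fun apply_gate :: "nat \<Rightarrow> bfun \<Rightarrow> gate \<Rightarrow> (bool list \<Rightarrow> complex) \<Rightarrow> bool list \<Rightarrow> complex" where
  "apply_gate n f (Hadamard i) \<psi> q =
     (\<psi> (q[i := False]) + (if q ! i then -1 else 1) * \<psi> (q[i := True])) / complex_of_real (sqrt 2)"
| "apply_gate n f (PhaseT i) \<psi> q = (if q ! i then cis (pi / 4) else 1) * \<psi> q"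
| "apply_gate n f (CNot i j) \<psi> q = \<psi> (q[j := (q ! j \<noteq> q ! i)])"
| "apply_gate n f (Query k) \<psi> q = \<psi> (xor_query n f k q)"

text \<open>\<open>circuit_entry n f gs q' q\<close> is the amplitude of q' after running gs with oracle f on
  the basis state q.\<close>

definition circuit_entry :: "nat \<Rightarrow> bfun \<Rightarrow> circuit \<Rightarrow> bool list \<Rightarrow> bool list \<Rightarrow> complex" where
  "circuit_entry n f gs q' q =
     fold (apply_gate n f) gs (\<lambda>r. if r = q then 1 else 0) q'"

definition forward :: "nat \<Rightarrow> circuit" where
  "forward n = [Query 0]"


section \<open>Efficient circuit families\<close>

text \<open>
  Efficient means polynomial-time uniform: one random access machine, started with n in
  register 0, halts after polynomially many steps having emitted the circuit for parameter n.
  Instructions have unit cost, and the only arithmetic is addition and truncated subtraction,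
  which makes polynomial time the same as for Turing machines given n in unary.
\<close>

datatype instr =
    Const nat nat
  | Add nat nat nat
  | Sub nat nat nat
  | Load nat nat
  | Store nat nat
  | JumpZero nat nat
  | EmitHadamard nat
  | EmitPhaseT nat
  | EmitCNot nat nat
  | EmitQuery nat

text \<open>Program counter, memory, and the gates emitted so far.\<close>

type_synonym config = "nat \<times> (nat \<Rightarrow> nat) \<times> circuit"

fun exec :: "instr \<Rightarrow> config \<Rightarrow> config" where
  "exec (Const r c) (pc, m, gs) = (pc + 1, m(r := c), gs)"
| "exec (Add r s t) (pc, m, gs) = (pc + 1, m(r := m s + m t), gs)"
| "exec (Sub r s t) (pc, m, gs) = (pc + 1, m(r := m s - m t), gs)"
| "exec (Load r s) (pc, m, gs) = (pc + 1, m(r := m (m s)), gs)"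
| "exec (Store r s) (pc, m, gs) = (pc + 1, m(m r := m s), gs)"
| "exec (JumpZero r l) (pc, m, gs) = (if m r = 0 then l else pc + 1, m, gs)"
| "exec (EmitHadamard r) (pc, m, gs) = (pc + 1, m, gs @ [Hadamard (m r)])"
| "exec (EmitPhaseT r) (pc, m, gs) = (pc + 1, m, gs @ [PhaseT (m r)])"
| "exec (EmitCNot r s) (pc, m, gs) = (pc + 1, m, gs @ [CNot (m r) (m s)])"
| "exec (EmitQuery r) (pc, m, gs) = (pc + 1, m, gs @ [Query (m r)])"

definition halted :: "instr list \<Rightarrow> config \<Rightarrow> bool" where
  "halted P c \<longleftrightarrow> length P \<le> fst c"

definition machine_step :: "instr list \<Rightarrow> config \<Rightarrow> config" where
  "machine_step P c = (if halted P c then c else exec (P ! fst c) c)"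

definition efficient :: "(nat \<Rightarrow> circuit) \<Rightarrow> bool" where
  "efficient S \<longleftrightarrow>
     (\<forall>n. \<forall>g \<in> set (S n). wf_gate g) \<and>
     (\<exists>P k. \<forall>n. \<exists>t \<le> n ^ k + k. \<exists>pc m.
        (machine_step P ^^ t) (0, (\<lambda>_. 0)(0 := n), []) = (pc, m, S n) \<and>
        halted P (pc, m, S n))"


section \<open>Distinguishers\<close>

text \<open>
  A basis state of the distinguisher consists of a selector for the oracle to be called, the 3n
  qubits of the query, and the workspace. Superpositions of the selector are allowed, so the
  choice of the oracle may be adaptive, by measurement or coherently.
  Skipping a query is possible as well: a forwarding private interface acts trivially on the
  uniform superposition in the response register.
\<close>

datatype iface = Priv | Pub

type_synonym dlabel = "iface \<times> bool list \<times> nat"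

text \<open>Matrices with entry i j in row i and column j; only indices in the relevant basis matter.\<close>

type_synonym dmat = "dlabel \<Rightarrow> dlabel \<Rightarrow> complex"

definition dbasis :: "nat \<Rightarrow> nat \<Rightarrow> dlabel set" where
  "dbasis n d = {Priv, Pub} \<times> bits (3 * n) \<times> {..<d}"

definition unitary_on :: "dlabel set \<Rightarrow> dmat \<Rightarrow> bool" where
  "unitary_on B U \<longleftrightarrow>
     (\<forall>i\<in>B. \<forall>j\<in>B. (\<Sum>k\<in>B. cnj (U k i) * U k j) = (if i = j then 1 else 0))"

text \<open>
  \<open>rounds\<close> are the unitaries applied before each of the queries, \<open>final\<close> is the one
  applied after the last query. The output bit is 1 if the final measurement in the computational
  basis yields an element of \<open>accept\<close>.
\<close>

record distinguisher =
  work_dim :: nat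
  rounds :: "dmat list"
  final :: dmat
  accept :: "dlabel set"

definition is_distinguisher :: "nat \<Rightarrow> distinguisher \<Rightarrow> bool" where
  "is_distinguisher n D \<longleftrightarrow>
     0 < work_dim D \<and>
     (\<forall>U \<in> set (rounds D). unitary_on (dbasis n (work_dim D)) U) \<and>
     unitary_on (dbasis n (work_dim D)) (final D)"

definition num_queries :: "distinguisher \<Rightarrow> nat" where
  "num_queries D = length (rounds D)"

definition conjugate :: "dlabel set \<Rightarrow> dmat \<Rightarrow> dmat \<Rightarrow> dmat" where
  "conjugate B M \<rho> = (\<lambda>i j. \<Sum>k\<in>B. \<Sum>l\<in>B. M i k * \<rho> k l * cnj (M j l))"

text \<open>
  A query runs the circuit of the selected interface with m fresh ancillas in state 0, which are
  traced out afterwards, so no state is kept between queries.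
  \<open>query_kraus\<close> is the Kraus operator belonging to the final ancilla state a.
\<close>

definition query_kraus ::
    "nat \<Rightarrow> bfun \<Rightarrow> (iface \<Rightarrow> circuit) \<Rightarrow> nat \<Rightarrow> bool list \<Rightarrow> dmat" where
  "query_kraus n f circ m a = (\<lambda>(b', q', w') (b, q, w).
     if b' = b \<and> w' = w
     then circuit_entry n f (circ b) (q' @ a) (q @ replicate m False) else 0)"

definition query_channel ::
    "nat \<Rightarrow> nat \<Rightarrow> bfun \<Rightarrow> (iface \<Rightarrow> circuit) \<Rightarrow> dmat \<Rightarrow> dmat" where
  "query_channel n d f circ \<rho> =
     (let m = max (width n (circ Priv)) (width n (circ Pub)) - 3 * n
      in (\<lambda>i j. \<Sum>a\<in>bits m. conjugate (dbasis n d) (query_kraus n f circ m a) \<rho> i j))"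

definition initial_state :: "nat \<Rightarrow> dmat" where
  "initial_state n =
     (let z = (Priv, replicate (3 * n) False, 0) in (\<lambda>i j. if i = z \<and> j = z then 1 else 0))"

definition final_state :: "nat \<Rightarrow> distinguisher \<Rightarrow> bfun \<Rightarrow> (iface \<Rightarrow> circuit) \<Rightarrow> dmat" where
  "final_state n D f circ =
     (let B = dbasis n (work_dim D)
      in conjugate B (final D)
           (fold (\<lambda>U \<rho>. query_channel n (work_dim D) f circ (conjugate B U \<rho>))
              (rounds D) (initial_state n)))"

definition accept_prob :: "nat \<Rightarrow> distinguisher \<Rightarrow> bfun \<Rightarrow> (iface \<Rightarrow> circuit) \<Rightarrow> real" where
  "accept_prob n D f circ =
     (\<Sum>i \<in> dbasis n (work_dim D) \<inter> accept D. Re (final_state n D f circ i i))"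


section \<open>Indifferentiability\<close>

text \<open>The public interface is an oracle for a random function; the private interface is an
  algorithm with oracle access to it.\<close>

record construction =
  pub :: "nat \<Rightarrow> bfun pmf"
  priv :: "nat \<Rightarrow> circuit"

definition real_prob :: "construction \<Rightarrow> nat \<Rightarrow> distinguisher \<Rightarrow> real" where
  "real_prob C n D =
     measure_pmf.expectation (pub C n)
       (\<lambda>f. accept_prob n D f (case_iface (priv C n) (forward n)))"

definition ideal_prob :: "construction \<Rightarrow> (nat \<Rightarrow> circuit) \<Rightarrow> nat \<Rightarrow> distinguisher \<Rightarrow> real" where
  "ideal_prob R S n D =
     measure_pmf.expectation (pub R n)
       (\<lambda>f. accept_prob n D f (case_iface (priv R n) (S n)))"

definition strong_quantum_statistical_reset_indifferentiable ::
    "construction \<Rightarrow> construction \<Rightarrow> (nat \<Rightarrow> nat) \<Rightarrow> (nat \<Rightarrow> real) \<Rightarrow> bool" where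
  "strong_quantum_statistical_reset_indifferentiable C R T \<epsilon> \<longleftrightarrow>
     (\<exists>S. efficient S \<and>
        (\<forall>n D. is_distinguisher n D \<and> num_queries D \<le> T n \<longrightarrow>
           \<bar>real_prob C n D - ideal_prob R S n D\<bar> \<le> \<epsilon> n))"

definition planted_construction :: construction where
  "planted_construction = \<lparr>pub = planted_fun, priv = forward\<rparr>"

definition random_construction :: construction where
  "random_construction = \<lparr>pub = uniform_fun, priv = forward\<rparr>"

end

theory Submission
  imports Defs
begin

text \<open>
  The simulator forwards. Up to a change of sampling order, g arises from a uniformly random h by
  reprogramming h at the inputs ending in an independent uniform s. Fix h and let \<open>\<delta>\<^sub>s\<close> be the
  difference between the final states of the distinguisher for the reprogrammed oracle and for h.
  As the parts of the state that query inputs ending in s are orthogonal for different s, the sum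
  over s of \<open>\<parallel>\<delta>\<^sub>s\<parallel>\<^sup>2\<close> is at most \<open>4 T\<^sup>2\<close>, and the sum of \<open>\<bar>\<langle>u, \<delta>\<^sub>s\<rangle>\<bar>\<close> is at most \<open>2 T\<^sup>2\<close> for any
  unit vector u. An acceptance probability changes by a term linear in \<open>\<delta>\<^sub>s\<close> and one quadratic in it,
  so its average over the \<open>2\<^sup>n\<close> values of s changes by at most \<open>8 T\<^sup>2 / 2\<^sup>n\<close>.
\<close>

section \<open>Finite-dimensional state vectors\<close>

definition mat_vec :: "'a set \<Rightarrow> ('a \<Rightarrow> 'a \<Rightarrow> complex) \<Rightarrow> ('a \<Rightarrow> complex) \<Rightarrow> 'a \<Rightarrow> complex" where
  "mat_vec B M u = (\<lambda>i. \<Sum>k\<in>B. M i k * u k)"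

definition vinner :: "'a set \<Rightarrow> ('a \<Rightarrow> complex) \<Rightarrow> ('a \<Rightarrow> complex) \<Rightarrow> complex" where
  "vinner B u v = (\<Sum>i\<in>B. cnj (u i) * v i)"

text \<open>Going through \<open>L2_set\<close> gives Cauchy-Schwarz and the triangle inequality,
  here for state vectors and later for families of norms indexed by the planted suffix.\<close>

definition vnorm :: "'a set \<Rightarrow> ('a \<Rightarrow> complex) \<Rightarrow> real" where
  "vnorm B u = L2_set (\<lambda>i. cmod (u i)) B"

definition adjoint_mat :: "('a \<Rightarrow> 'a \<Rightarrow> complex) \<Rightarrow> 'a \<Rightarrow> 'a \<Rightarrow> complex" where
  "adjoint_mat M = (\<lambda>k i. cnj (M i k))"

lemma vnorm_nonneg [simp]: "0 \<le> vnorm B u"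
  by (simp add: vnorm_def)

lemma vnorm_power2: "(vnorm B u)\<^sup>2 = (\<Sum>i\<in>B. (cmod (u i))\<^sup>2)"
  by (simp add: vnorm_def L2_set_def sum_nonneg)

lemma vinner_self: "vinner B u u = complex_of_real ((vnorm B u)\<^sup>2)"
  unfolding vinner_def vnorm_power2 of_real_sum
  by (intro sum.cong refl) (metis complex_norm_square mult.commute)

lemma cmod_vinner_le: "cmod (vinner B u v) \<le> vnorm B u * vnorm B v"
proof -
  have "cmod (vinner B u v) \<le> (\<Sum>i\<in>B. \<bar>cmod (u i)\<bar> * \<bar>cmod (v i)\<bar>)"
    unfolding vinner_def by (rule sum_norm_le) (simp add: norm_mult)
  also have "\<dots> \<le> vnorm B u * vnorm B v"
    unfolding vnorm_def by (rule L2_set_mult_ineq)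
  finally show ?thesis .
qed

lemma vnorm_mono: "(\<And>i. i \<in> B \<Longrightarrow> cmod (u i) \<le> cmod (v i)) \<Longrightarrow> vnorm B u \<le> vnorm B v"
  unfolding vnorm_def by (rule L2_set_mono) auto

lemma vnorm_add_le: "vnorm B (\<lambda>i. u i + v i) \<le> vnorm B u + vnorm B v"
proof -
  have "vnorm B (\<lambda>i. u i + v i) \<le> L2_set (\<lambda>i. cmod (u i) + cmod (v i)) B"
    unfolding vnorm_def by (rule L2_set_mono) (auto simp: norm_triangle_ineq)
  also have "\<dots> \<le> vnorm B u + vnorm B v"
    unfolding vnorm_def by (rule L2_set_triangle_ineq)
  finally show ?thesis .
qed

lemma vnorm_diff_le: "vnorm B (\<lambda>i. u i - v i) \<le> vnorm B u + vnorm B v"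
  using vnorm_add_le[of B u "\<lambda>i. - v i"] by (simp add: vnorm_def)

lemma vnorm_reindex:
  assumes "bij_betw \<pi> B B"
  shows "vnorm B (\<lambda>i. u (\<pi> i)) = vnorm B u"
  unfolding vnorm_def L2_set_def
  using sum.reindex_bij_betw[OF assms, of "\<lambda>i. (cmod (u i))\<^sup>2"] by simp

lemma vinner_add_right: "vinner B u (\<lambda>i. v i + w i) = vinner B u v + vinner B u w"
  by (simp add: vinner_def distrib_left sum.distrib)

lemma mat_vec_diff: "mat_vec B M (\<lambda>i. u i - v i) = (\<lambda>i. mat_vec B M u i - mat_vec B M v i)"
  by (simp add: mat_vec_def right_diff_distrib sum_subtractf)

lemma vinner_adjoint: "vinner B u (mat_vec B M v) = vinner B (mat_vec B (adjoint_mat M) u) v"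
proof -
  have "vinner B u (mat_vec B M v) = (\<Sum>i\<in>B. \<Sum>k\<in>B. cnj (u i) * M i k * v k)"
    by (simp add: vinner_def mat_vec_def sum_distrib_left mult.assoc)
  also have "\<dots> = (\<Sum>k\<in>B. \<Sum>i\<in>B. cnj (u i) * M i k * v k)"
    by (rule sum.swap)
  also have "\<dots> = vinner B (mat_vec B (adjoint_mat M) u) v"
    by (simp add: vinner_def mat_vec_def adjoint_mat_def sum_distrib_left mult_ac)
  finally show ?thesis .
qed

text \<open>\<open>unitary_on\<close> says that the adjoint of \<open>M\<close> is a left inverse of
  \<open>M\<close> on \<open>B\<close>; moving \<open>M\<close> across the inner product of
  \<open>M\<close> u with itself therefore leaves that of u with itself.\<close>

lemma vnorm_unitary:
  assumes "finite B" "unitary_on B M"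
  shows "vnorm B (mat_vec B M u) = vnorm B u"
proof -
  have "mat_vec B (adjoint_mat M) (mat_vec B M u) i = u i" if "i \<in> B" for i
  proof -
    have "mat_vec B (adjoint_mat M) (mat_vec B M u) i
        = (\<Sum>k\<in>B. \<Sum>j\<in>B. cnj (M k i) * M k j * u j)"
      by (simp add: mat_vec_def adjoint_mat_def sum_distrib_left mult.assoc)
    also have "\<dots> = (\<Sum>j\<in>B. (\<Sum>k\<in>B. cnj (M k i) * M k j) * u j)"
      by (subst sum.swap) (simp add: sum_distrib_right)
    also have "\<dots> = (\<Sum>j\<in>B. (if i = j then 1 else 0) * u j)"
      using assms(2) that by (intro sum.cong) (auto simp: unitary_on_def)
    also have "\<dots> = (\<Sum>j\<in>B. if i = j then u j else 0)"
      by (intro sum.cong) auto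
    also have "\<dots> = u i"
      using that assms(1) by simp
    finally show ?thesis .
  qed
  then have "vinner B (mat_vec B (adjoint_mat M) (mat_vec B M u)) u = vinner B u u"
    by (auto simp: vinner_def intro!: sum.cong)
  then have "vinner B (mat_vec B M u) (mat_vec B M u) = vinner B u u"
    by (simp add: vinner_adjoint)
  then have "(vnorm B (mat_vec B M u))\<^sup>2 = (vnorm B u)\<^sup>2"
    unfolding vinner_self of_real_eq_iff .
  then show ?thesis by simp
qed

text \<open>If v is the image of u under the adjoint, then the squared norm of v is the inner
  product of u with \<open>M\<close> v. As \<open>M\<close> is an isometry, Cauchy-Schwarz bounds it
  by the product of the norms of u and v, and one norm of v cancels.\<close>

lemma vnorm_adjoint_le:
  assumes "finite B" "unitary_on B M"
  shows "vnorm B (mat_vec B (adjoint_mat M) u) \<le> vnorm B u"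
proof -
  let ?v = "mat_vec B (adjoint_mat M) u"
  have "(vnorm B ?v)\<^sup>2 = cmod (vinner B ?v ?v)"
    by (simp only: vinner_self norm_of_real abs_power2)
  also have "\<dots> = cmod (vinner B u (mat_vec B M ?v))"
    by (simp add: vinner_adjoint)
  also have "\<dots> \<le> vnorm B u * vnorm B ?v"
    using cmod_vinner_le[of B u "mat_vec B M ?v"] by (simp add: vnorm_unitary assms)
  finally have "vnorm B ?v * vnorm B ?v \<le> vnorm B u * vnorm B ?v"
    by (simp add: power2_eq_square)
  then show ?thesis
    by (smt (verit) mult_right_le_imp_le vnorm_nonneg)
qed

text \<open>The permuted matrix describes \<open>U\<close> followed by an oracle query, so a whole
  round can be moved across an inner product at once.\<close>

lemma unitary_on_permute_rows:
  assumes "bij_betw \<pi> B B" "unitary_on B U"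
  shows "unitary_on B (\<lambda>i. U (\<pi> i))"
  unfolding unitary_on_def
proof (intro ballI)
  fix i j assume "i \<in> B" "j \<in> B"
  have "(\<Sum>k\<in>B. cnj (U (\<pi> k) i) * U (\<pi> k) j) = (\<Sum>k\<in>B. cnj (U k i) * U k j)"
    by (rule sum.reindex_bij_betw[OF assms(1)])
  with assms(2) \<open>i \<in> B\<close> \<open>j \<in> B\<close>
  show "(\<Sum>k\<in>B. cnj (U (\<pi> k) i) * U (\<pi> k) j) = (if i = j then 1 else 0)"
    by (simp add: unitary_on_def)
qed


section \<open>Reprogramming one of many disjoint parts of an oracle\<close>

text \<open>The oracle enters only as a permutation of basis labels, which keeps the estimates of
  this section free of bit strings.\<close>

definition run :: "'a set \<Rightarrow> ('a \<Rightarrow> 'a) \<Rightarrow> ('a \<Rightarrow> 'a \<Rightarrow> complex) list \<Rightarrow> ('a \<Rightarrow> complex) \<Rightarrow> 'a \<Rightarrow> complex" where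
  "run B \<pi> Us \<psi> = fold (\<lambda>U \<psi> i. mat_vec B U \<psi> (\<pi> i)) Us \<psi>"

lemma run_snoc: "run B \<pi> (Us @ [U]) \<psi> = (\<lambda>i. mat_vec B U (run B \<pi> Us \<psi>) (\<pi> i))"
  by (simp add: run_def)

lemma vnorm_run:
  assumes "finite B" "bij_betw \<pi> B B" "\<forall>U\<in>set Us. unitary_on B U"
  shows "vnorm B (run B \<pi> Us \<psi>) = vnorm B \<psi>"
  using assms(3)
  by (induction Us rule: rev_induct)
     (auto simp: run_snoc vnorm_reindex[OF assms(2)] vnorm_unitary[OF assms(1)], simp add: run_def)

text \<open>Intended reading: \<open>cls\<close> is the suffix of the query input,
  \<open>\<pi>\<close> a query to h, and \<open>\<pi>' s\<close> a query to h reprogrammed on inputs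
  with suffix s. Queries preserve the input and hence the class.\<close>

locale reprogrammed_oracle =
  fixes B :: "dlabel set" and I :: "'i set" and cls :: "dlabel \<Rightarrow> 'i"
    and \<pi> :: "dlabel \<Rightarrow> dlabel" and \<pi>' :: "'i \<Rightarrow> dlabel \<Rightarrow> dlabel"
  assumes finite_B: "finite B" and finite_I: "finite I"
    and cls_in: "i \<in> B \<Longrightarrow> cls i \<in> I"
    and bij: "bij_betw \<pi> B B"
    and bij': "s \<in> I \<Longrightarrow> bij_betw (\<pi>' s) B B"
    and cls_\<pi>: "i \<in> B \<Longrightarrow> cls (\<pi> i) = cls i"
    and cls_\<pi>': "s \<in> I \<Longrightarrow> i \<in> B \<Longrightarrow> cls (\<pi>' s i) = cls i"
    and agree: "s \<in> I \<Longrightarrow> i \<in> B \<Longrightarrow> cls i \<noteq> s \<Longrightarrow> \<pi>' s i = \<pi> i"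
begin

definition part :: "'i \<Rightarrow> (dlabel \<Rightarrow> complex) \<Rightarrow> dlabel \<Rightarrow> complex" where
  "part s v = (\<lambda>i. if cls i = s then v i else 0)"

definition gap :: "'i \<Rightarrow> (dlabel \<Rightarrow> complex) \<Rightarrow> dlabel \<Rightarrow> complex" where
  "gap s v = (\<lambda>i. v (\<pi>' s i) - v (\<pi> i))"

text \<open>The comparison is made before the final unitary, which preserves norms and can be moved
  onto a fixed test vector.\<close>

definition deviation :: "'i \<Rightarrow> dmat list \<Rightarrow> (dlabel \<Rightarrow> complex) \<Rightarrow> dlabel \<Rightarrow> complex" where
  "deviation s Us \<psi> = (\<lambda>i. run B (\<pi>' s) Us \<psi> i - run B \<pi> Us \<psi> i)"

text \<open>Pythagoras: every basis label lies in exactly one class, so the parts are orthogonal and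
  add up to the vector.\<close>

lemma sum_vnorm_part: "(\<Sum>s\<in>I. (vnorm B (part s v))\<^sup>2) = (vnorm B v)\<^sup>2"
proof -
  have "(\<Sum>s\<in>I. (vnorm B (part s v))\<^sup>2) = (\<Sum>i\<in>B. \<Sum>s\<in>I. (cmod (part s v i))\<^sup>2)"
    unfolding vnorm_power2 by (rule sum.swap)
  also have "\<dots> = (\<Sum>i\<in>B. (cmod (v i))\<^sup>2)"
  proof (intro sum.cong refl)
    fix i assume "i \<in> B"
    have "(\<Sum>s\<in>I. (cmod (part s v i))\<^sup>2) = (\<Sum>s\<in>I. if cls i = s then (cmod (v i))\<^sup>2 else 0)"
      by (intro sum.cong) (auto simp: part_def)
    also have "\<dots> = (cmod (v i))\<^sup>2"
      using cls_in[OF \<open>i \<in> B\<close>] finite_I by simp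
    finally show "(\<Sum>s\<in>I. (cmod (part s v i))\<^sup>2) = (cmod (v i))\<^sup>2" .
  qed
  finally show ?thesis by (simp add: vnorm_power2)
qed

lemma L2_vnorm_part: "L2_set (\<lambda>s. vnorm B (part s v)) I = vnorm B v"
  unfolding L2_set_def sum_vnorm_part by simp

lemma vnorm_part_le: "vnorm B (part s v) \<le> vnorm B v"
  by (rule vnorm_mono) (simp add: part_def)

text \<open>Outside class s the two queries coincide and cancel. Inside it both stay in the class,
  so only the part of v in class s contributes, once for each of two norm-preserving
  permutations.\<close>

lemma vnorm_gap_le:
  assumes s: "s \<in> I"
  shows "vnorm B (gap s v) \<le> 2 * vnorm B (part s v)"
proof -
  have "vnorm B (gap s v) \<le> vnorm B (\<lambda>i. part s v (\<pi>' s i) - part s v (\<pi> i))"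
    by (rule vnorm_mono) (auto simp: gap_def part_def cls_\<pi> cls_\<pi>' s agree)
  also have "\<dots> \<le> vnorm B (\<lambda>i. part s v (\<pi>' s i)) + vnorm B (\<lambda>i. part s v (\<pi> i))"
    by (rule vnorm_diff_le)
  also have "\<dots> = 2 * vnorm B (part s v)"
    by (simp add: vnorm_reindex[OF bij] vnorm_reindex[OF bij'[OF s]])
  finally show ?thesis .
qed

text \<open>The gap is supported on class s, so u may be replaced by its part there before
  Cauchy-Schwarz is applied.\<close>

lemma cmod_vinner_gap_le:
  assumes s: "s \<in> I"
  shows "cmod (vinner B u (gap s v)) \<le> 2 * (vnorm B (part s u) * vnorm B (part s v))"
proof -
  have "vinner B u (gap s v) = vinner B (part s u) (gap s v)"
    unfolding vinner_def by (intro sum.cong) (auto simp: part_def gap_def agree s)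
  then have "cmod (vinner B u (gap s v)) \<le> vnorm B (part s u) * vnorm B (gap s v)"
    by (simp add: cmod_vinner_le)
  also have "\<dots> \<le> vnorm B (part s u) * (2 * vnorm B (part s v))"
    by (intro mult_left_mono vnorm_gap_le s vnorm_nonneg)
  finally show ?thesis by simp
qed

text \<open>A hybrid argument in the 2-norm over s: each round adds the gaps of one vector, whose
  parts have total 2-norm equal to the norm of the initial state. So a query costs 2, however many
  classes there are.\<close>

lemma L2_deviation_le:
  assumes "\<forall>U\<in>set Us. unitary_on B U"
  shows "L2_set (\<lambda>s. vnorm B (deviation s Us \<psi>)) I \<le> 2 * real (length Us) * vnorm B \<psi>"
  using assms
proof (induction Us rule: rev_induct)
  case Nil
  then show ?case by (simp add: deviation_def run_def vnorm_def L2_set_def)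
next
  case (snoc U Us)
  let ?\<phi> = "mat_vec B U (run B \<pi> Us \<psi>)"
  have U: "unitary_on B U" and Us: "\<forall>U\<in>set Us. unitary_on B U"
    using snoc.prems by auto
  have "vnorm B (deviation s (Us @ [U]) \<psi>)
      \<le> vnorm B (deviation s Us \<psi>) + 2 * vnorm B (part s ?\<phi>)" if s: "s \<in> I" for s
  proof -
    \<comment> \<open>The old deviation is carried along by the reprogrammed query, so that the new
      error is a gap of the undisturbed state \<open>?\<phi>\<close>, which is the same for all
      s.\<close>
    have "deviation s (Us @ [U]) \<psi> = (\<lambda>i. mat_vec B U (deviation s Us \<psi>) (\<pi>' s i) + gap s ?\<phi> i)"
      by (simp add: deviation_def run_snoc gap_def mat_vec_diff)
    then have "vnorm B (deviation s (Us @ [U]) \<psi>)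
        \<le> vnorm B (\<lambda>i. mat_vec B U (deviation s Us \<psi>) (\<pi>' s i)) + vnorm B (gap s ?\<phi>)"
      by (simp add: vnorm_add_le)
    also have "\<dots> \<le> vnorm B (deviation s Us \<psi>) + 2 * vnorm B (part s ?\<phi>)"
      using vnorm_gap_le[OF s, of ?\<phi>]
      by (simp add: vnorm_reindex[OF bij'[OF s]] vnorm_unitary[OF finite_B U])
    finally show ?thesis .
  qed
  then have "L2_set (\<lambda>s. vnorm B (deviation s (Us @ [U]) \<psi>)) I
      \<le> L2_set (\<lambda>s. vnorm B (deviation s Us \<psi>) + 2 * vnorm B (part s ?\<phi>)) I"
    by (intro L2_set_mono) auto
  also have "\<dots> \<le> L2_set (\<lambda>s. vnorm B (deviation s Us \<psi>)) I
      + L2_set (\<lambda>s. 2 * vnorm B (part s ?\<phi>)) I"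
    by (rule L2_set_triangle_ineq)
  also have "L2_set (\<lambda>s. 2 * vnorm B (part s ?\<phi>)) I = 2 * vnorm B ?\<phi>"
    using L2_set_right_distrib[of 2 "\<lambda>s. vnorm B (part s ?\<phi>)" I] by (simp add: L2_vnorm_part)
  also have "vnorm B ?\<phi> = vnorm B \<psi>"
    by (simp add: vnorm_unitary[OF finite_B U] vnorm_run[OF finite_B bij Us])
  also have "L2_set (\<lambda>s. vnorm B (deviation s Us \<psi>)) I + 2 * vnorm B \<psi>
      \<le> 2 * real (length (Us @ [U])) * vnorm B \<psi>"
    using snoc.IH[OF Us] by (simp add: algebra_simps)
  finally show ?case by simp
qed

text \<open>Pulling the last query back onto the fixed vector u by the adjoint isolates terms in which
  both factors are restricted to the part s, so that summing over s costs no factor; this is what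
  yields a quadratic bound where the triangle inequality would lose a square root of the number
  of parts.\<close>

lemma sum_vinner_deviation_le:
  assumes "\<forall>U\<in>set Us. unitary_on B U"
  shows "(\<Sum>s\<in>I. cmod (vinner B u (deviation s Us \<psi>))) \<le> 2 * (real (length Us))\<^sup>2 * (vnorm B u * vnorm B \<psi>)"
  using assms
\<comment> \<open>The test vector is generalised because pulling back a round replaces it by
  \<open>?u\<close>.\<close>
proof (induction Us arbitrary: u rule: rev_induct)
  case Nil
  then show ?case by (simp add: deviation_def run_def vinner_def)
next
  case (snoc U Us)
  let ?\<phi> = "mat_vec B U (run B \<pi> Us \<psi>)"
  let ?M = "\<lambda>i. U (\<pi> i)"
  let ?u = "mat_vec B (adjoint_mat ?M) u"
  let ?\<delta> = "\<lambda>s. deviation s Us \<psi>"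
  let ?T = "real (length Us)"
  have U: "unitary_on B U" and Us: "\<forall>U\<in>set Us. unitary_on B U"
    using snoc.prems by auto
  have norm_\<phi>: "vnorm B ?\<phi> = vnorm B \<psi>"
    by (simp add: vnorm_unitary[OF finite_B U] vnorm_run[OF finite_B bij Us])
  have "cmod (vinner B u (deviation s (Us @ [U]) \<psi>))
      \<le> cmod (vinner B ?u (?\<delta> s)) + 2 * (vnorm B (part s u) * vnorm B (part s ?\<phi>))
        + 2 * (vnorm B (part s u) * vnorm B (?\<delta> s))" if s: "s \<in> I" for s
  proof -
    \<comment> \<open>This time the old deviation is carried along by the original query, because
      the matrix pulled back onto u must not depend on s. The price is the third term, a gap of the
      deviation itself.\<close>
    have "deviation s (Us @ [U]) \<psi>
        = (\<lambda>i. mat_vec B ?M (?\<delta> s) i + (gap s ?\<phi> i + gap s (mat_vec B U (?\<delta> s)) i))"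
      by (simp add: deviation_def run_snoc gap_def mat_vec_diff mat_vec_def right_diff_distrib
          sum_subtractf)
    then have "vinner B u (deviation s (Us @ [U]) \<psi>) = vinner B ?u (?\<delta> s)
        + (vinner B u (gap s ?\<phi>) + vinner B u (gap s (mat_vec B U (?\<delta> s))))"
      by (simp only: vinner_add_right vinner_adjoint)
    then have "cmod (vinner B u (deviation s (Us @ [U]) \<psi>)) \<le> cmod (vinner B ?u (?\<delta> s))
        + (cmod (vinner B u (gap s ?\<phi>)) + cmod (vinner B u (gap s (mat_vec B U (?\<delta> s)))))"
      by (smt (verit) norm_triangle_ineq)
    \<comment> \<open>The second factor keeps its full norm. In the sum over s, Cauchy-Schwarz pairs
      the parts of u with the deviations, whose 2-norm over s grows only linearly in the number of
      queries.\<close>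
    moreover have "cmod (vinner B u (gap s (mat_vec B U (?\<delta> s))))
        \<le> 2 * (vnorm B (part s u) * vnorm B (?\<delta> s))"
    proof -
      have "vnorm B (part s (mat_vec B U (?\<delta> s))) \<le> vnorm B (?\<delta> s)"
        using vnorm_part_le[of s "mat_vec B U (?\<delta> s)"] by (simp add: vnorm_unitary[OF finite_B U])
      then show ?thesis
        using cmod_vinner_gap_le[OF s, of u "mat_vec B U (?\<delta> s)"]
          mult_left_mono[of _ "vnorm B (?\<delta> s)" "vnorm B (part s u)"]
        by (smt (verit) vnorm_nonneg)
    qed
    ultimately show ?thesis
      using cmod_vinner_gap_le[OF s, of u ?\<phi>] by linarith
  qed
  then have "(\<Sum>s\<in>I. cmod (vinner B u (deviation s (Us @ [U]) \<psi>)))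
      \<le> (\<Sum>s\<in>I. cmod (vinner B ?u (?\<delta> s)) + 2 * (vnorm B (part s u) * vnorm B (part s ?\<phi>))
        + 2 * (vnorm B (part s u) * vnorm B (?\<delta> s)))"
    by (rule sum_mono)
  also have "\<dots> = (\<Sum>s\<in>I. cmod (vinner B ?u (?\<delta> s)))
      + 2 * (\<Sum>s\<in>I. vnorm B (part s u) * vnorm B (part s ?\<phi>))
      + 2 * (\<Sum>s\<in>I. vnorm B (part s u) * vnorm B (?\<delta> s))"
    by (simp add: sum.distrib sum_distrib_left)
  also have "\<dots> \<le> 2 * ?T\<^sup>2 * (vnorm B u * vnorm B \<psi>) + 2 * (vnorm B u * vnorm B \<psi>)
      + 2 * (vnorm B u * (2 * ?T * vnorm B \<psi>))"
  proof (intro add_mono mult_left_mono)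
    have "vnorm B ?u \<le> vnorm B u"
      by (rule vnorm_adjoint_le[OF finite_B unitary_on_permute_rows[OF bij U]])
    then have "2 * ?T\<^sup>2 * (vnorm B ?u * vnorm B \<psi>) \<le> 2 * ?T\<^sup>2 * (vnorm B u * vnorm B \<psi>)"
      by (intro mult_left_mono mult_right_mono) auto
    with snoc.IH[OF Us, of ?u]
    show "(\<Sum>s\<in>I. cmod (vinner B ?u (?\<delta> s))) \<le> 2 * ?T\<^sup>2 * (vnorm B u * vnorm B \<psi>)"
      by simp
    show "(\<Sum>s\<in>I. vnorm B (part s u) * vnorm B (part s ?\<phi>)) \<le> vnorm B u * vnorm B \<psi>"
      using L2_set_mult_ineq[of "\<lambda>s. vnorm B (part s u)" "\<lambda>s. vnorm B (part s ?\<phi>)" I]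
      by (simp add: L2_vnorm_part norm_\<phi>)
    have "(\<Sum>s\<in>I. vnorm B (part s u) * vnorm B (?\<delta> s))
        \<le> vnorm B u * L2_set (\<lambda>s. vnorm B (?\<delta> s)) I"
      using L2_set_mult_ineq[of "\<lambda>s. vnorm B (part s u)" "\<lambda>s. vnorm B (?\<delta> s)" I]
      by (simp add: L2_vnorm_part)
    also have "\<dots> \<le> vnorm B u * (2 * ?T * vnorm B \<psi>)"
      by (intro mult_left_mono L2_deviation_le[OF Us] vnorm_nonneg)
    finally show "(\<Sum>s\<in>I. vnorm B (part s u) * vnorm B (?\<delta> s))
        \<le> vnorm B u * (2 * ?T * vnorm B \<psi>)" .
  qed auto
  \<comment> \<open>The three contributions complete the square: 2 T^2 + 2 + 4 T = 2 (T +
    1)^2.\<close>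
  also have "\<dots> = 2 * (real (length (Us @ [U])))\<^sup>2 * (vnorm B u * vnorm B \<psi>)"
    by (simp add: algebra_simps power2_eq_square)
  finally show ?case .
qed

lemma sum_prob_diff_le:
  assumes Us: "\<forall>U\<in>set Us. unitary_on B U" and V: "unitary_on B V"
    and A: "A \<subseteq> B" and \<psi>: "vnorm B \<psi> = 1"
  shows "(\<Sum>s\<in>I. \<bar>(vnorm A (mat_vec B V (run B (\<pi>' s) Us \<psi>)))\<^sup>2
      - (vnorm A (mat_vec B V (run B \<pi> Us \<psi>)))\<^sup>2\<bar>) \<le> 8 * (real (length Us))\<^sup>2"
proof -
  let ?\<phi> = "mat_vec B V (run B \<pi> Us \<psi>)"
  let ?\<delta> = "\<lambda>s. deviation s Us \<psi>"
  \<comment> \<open>The linear term is an inner product of the deviation with \<open>?u\<close>, the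
    accepted part of the undisturbed final state pulled back through \<open>V\<close>; this vector
    is the same for all s.\<close>
  let ?\<chi> = "\<lambda>i. if i \<in> A then ?\<phi> i else 0"
  let ?u = "mat_vec B (adjoint_mat V) ?\<chi>"
  let ?T = "real (length Us)"
  have "vnorm B ?u \<le> vnorm B ?\<chi>"
    by (rule vnorm_adjoint_le[OF finite_B V])
  also have "\<dots> \<le> vnorm B ?\<phi>"
    by (rule vnorm_mono) auto
  also have "\<dots> = 1"
    by (simp add: vnorm_unitary[OF finite_B V] vnorm_run[OF finite_B bij Us] \<psi>)
  finally have norm_u: "vnorm B ?u \<le> 1" .
  have "\<bar>(vnorm A (mat_vec B V (run B (\<pi>' s) Us \<psi>)))\<^sup>2 - (vnorm A ?\<phi>)\<^sup>2\<bar>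
      \<le> 2 * cmod (vinner B ?u (?\<delta> s)) + (vnorm B (?\<delta> s))\<^sup>2" if "s \<in> I" for s
  proof -
    let ?e = "mat_vec B V (?\<delta> s)"
    have split: "mat_vec B V (run B (\<pi>' s) Us \<psi>) = (\<lambda>i. ?\<phi> i + ?e i)"
      by (simp add: deviation_def mat_vec_diff)
    have sq: "(cmod (a + b))\<^sup>2 - (cmod a)\<^sup>2 = 2 * Re (cnj a * b) + (cmod b)\<^sup>2" for a b :: complex
      unfolding cmod_power2 by (simp add: power2_eq_square algebra_simps)
    have "(vnorm A (mat_vec B V (run B (\<pi>' s) Us \<psi>)))\<^sup>2 - (vnorm A ?\<phi>)\<^sup>2
        = (\<Sum>i\<in>A. (cmod (?\<phi> i + ?e i))\<^sup>2 - (cmod (?\<phi> i))\<^sup>2)"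
      by (simp add: split vnorm_power2 sum_subtractf)
    also have "\<dots> = 2 * Re (vinner A ?\<phi> ?e) + (vnorm A ?e)\<^sup>2"
      unfolding sq by (simp add: sum.distrib sum_distrib_left vnorm_power2 vinner_def)
    finally have "\<bar>(vnorm A (mat_vec B V (run B (\<pi>' s) Us \<psi>)))\<^sup>2 - (vnorm A ?\<phi>)\<^sup>2\<bar>
        \<le> 2 * cmod (vinner A ?\<phi> ?e) + (vnorm A ?e)\<^sup>2"
      using abs_Re_le_cmod[of "vinner A ?\<phi> ?e"] zero_le_power2[of "vnorm A ?e"] by linarith
    also have "vinner A ?\<phi> ?e = vinner B ?\<chi> ?e"
      unfolding vinner_def using A finite_B by (intro sum.mono_neutral_cong_left) auto
    also have "vinner B ?\<chi> ?e = vinner B ?u (?\<delta> s)"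
      by (rule vinner_adjoint)
    finally have "\<bar>(vnorm A (mat_vec B V (run B (\<pi>' s) Us \<psi>)))\<^sup>2 - (vnorm A ?\<phi>)\<^sup>2\<bar>
        \<le> 2 * cmod (vinner B ?u (?\<delta> s)) + (vnorm A ?e)\<^sup>2" .
    moreover have "(vnorm A ?e)\<^sup>2 \<le> (vnorm B ?e)\<^sup>2"
      unfolding vnorm_power2 using A finite_B by (intro sum_mono2) auto
    then have "(vnorm A ?e)\<^sup>2 \<le> (vnorm B (?\<delta> s))\<^sup>2"
      by (simp add: vnorm_unitary[OF finite_B V])
    ultimately show ?thesis by linarith
  qed
  then have "(\<Sum>s\<in>I. \<bar>(vnorm A (mat_vec B V (run B (\<pi>' s) Us \<psi>)))\<^sup>2 - (vnorm A ?\<phi>)\<^sup>2\<bar>)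
      \<le> (\<Sum>s\<in>I. 2 * cmod (vinner B ?u (?\<delta> s)) + (vnorm B (?\<delta> s))\<^sup>2)"
    by (rule sum_mono)
  also have "\<dots> = 2 * (\<Sum>s\<in>I. cmod (vinner B ?u (?\<delta> s))) + (\<Sum>s\<in>I. (vnorm B (?\<delta> s))\<^sup>2)"
    by (simp add: sum.distrib sum_distrib_left)
  \<comment> \<open>The linear term contributes twice 2 T^2 and the quadratic term (2 T)^2.\<close>
  also have "\<dots> \<le> 2 * (2 * ?T\<^sup>2) + (2 * ?T)\<^sup>2"
  proof (intro add_mono mult_left_mono)
    have "2 * ?T\<^sup>2 * (vnorm B ?u * 1) \<le> 2 * ?T\<^sup>2 * 1"
      using norm_u by (intro mult_left_mono) auto
    then show "(\<Sum>s\<in>I. cmod (vinner B ?u (?\<delta> s))) \<le> 2 * ?T\<^sup>2"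
      using sum_vinner_deviation_le[OF Us, of ?u \<psi>] \<psi> by simp
    have "(L2_set (\<lambda>s. vnorm B (?\<delta> s)) I)\<^sup>2 \<le> (2 * ?T)\<^sup>2"
      using L2_deviation_le[OF Us, of \<psi>] \<psi> by (intro power_mono) auto
    then show "(\<Sum>s\<in>I. (vnorm B (?\<delta> s))\<^sup>2) \<le> (2 * ?T)\<^sup>2"
      by (simp add: L2_set_def sum_nonneg)
  qed auto
  also have "\<dots> = 8 * ?T\<^sup>2"
    by (simp add: power_mult_distrib)
  finally show ?thesis .
qed

end

section \<open>Oracle queries and acceptance probabilities\<close>

text \<open>Both interfaces forward, so the selector b has no influence on the action of a
  query.\<close>

definition query_perm :: "nat \<Rightarrow> bfun \<Rightarrow> dlabel \<Rightarrow> dlabel" where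
  "query_perm n f = (\<lambda>(b, q, w). (b, xor_query n f 0 q, w))"

section \<open>Queries as involutions of the basis labels\<close>

lemma finite_bits: "finite (bits n)"
  using finite_lists_length_eq[of "UNIV :: bool set" n] by (simp add: bits_def)

lemma card_bits: "card (bits n) = 2 ^ n"
  using card_lists_length_eq[of "UNIV :: bool set" n] by (simp add: bits_def)

lemma bits_nonempty: "bits n \<noteq> {}"
  using card_bits[of n] by auto

lemma finite_dbasis: "finite (dbasis n d)"
  by (auto simp: dbasis_def finite_bits)

lemma xor_twice: "length a = length c \<Longrightarrow> map2 (\<noteq>) (map2 (\<noteq>) a c) c = a"
  by (induction a c rule: list_induct2) auto

lemma xor_query_in_bits:
  assumes "f \<in> bits (2 * n) \<rightarrow> bits n" "q \<in> bits (3 * n)"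
  shows "xor_query n f 0 q \<in> bits (3 * n)"
proof -
  have "take (2 * n) q \<in> bits (2 * n)"
    using assms(2) by (auto simp: bits_def)
  then have "f (take (2 * n) q) \<in> bits n"
    using assms(1) by blast
  then show ?thesis
    using assms(2) by (auto simp: bits_def xor_query_def)
qed

lemma take_xor_query:
  assumes "q \<in> bits (3 * n)"
  shows "take (2 * n) (xor_query n f 0 q) = take (2 * n) q"
  using assms by (auto simp: bits_def xor_query_def)

lemma xor_query_twice:
  assumes f: "f \<in> bits (2 * n) \<rightarrow> bits n" and q: "q \<in> bits (3 * n)"
  shows "xor_query n f 0 (xor_query n f 0 q) = q"
proof -
  let ?x = "take (2 * n) q" and ?y = "drop (2 * n) q"
  have "?x \<in> bits (2 * n)"
    using q by (auto simp: bits_def)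
  then have "f ?x \<in> bits n"
    using f by blast
  then have fx: "length (f ?x) = n"
    by (simp add: bits_def)
  have y: "length ?y = n" and x: "length ?x = 2 * n"
    using q by (auto simp: bits_def)
  \<comment> \<open>On 3n bits the response register is all that follows the input, so the trailing
    segment of \<open>xor_query\<close> is empty.\<close>
  have xor: "xor_query n f 0 r = take (2 * n) r @ map2 (\<noteq>) (drop (2 * n) r) (f (take (2 * n) r))"
    if "length r = 3 * n" for r
    using that by (auto simp: xor_query_def)
  have "xor_query n f 0 q = ?x @ map2 (\<noteq>) ?y (f ?x)"
    using q by (intro xor) (simp add: bits_def)
  moreover have "xor_query n f 0 (?x @ map2 (\<noteq>) ?y (f ?x)) = ?x @ map2 (\<noteq>) (map2 (\<noteq>) ?y (f ?x)) (f ?x)"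
    using x y fx by (subst xor) auto
  ultimately show ?thesis
    using xor_twice[of ?y "f ?x"] y fx by simp
qed

lemma query_perm_in_dbasis:
  assumes "f \<in> bits (2 * n) \<rightarrow> bits n" "i \<in> dbasis n d"
  shows "query_perm n f i \<in> dbasis n d"
  using assms(2) xor_query_in_bits[OF assms(1)] by (auto simp: query_perm_def dbasis_def)

lemma bij_query_perm:
  assumes "f \<in> bits (2 * n) \<rightarrow> bits n"
  shows "bij_betw (query_perm n f) (dbasis n d) (dbasis n d)"
proof -
  have "\<forall>i\<in>dbasis n d. query_perm n f (query_perm n f i) = i"
    by (auto simp: query_perm_def dbasis_def xor_query_twice[OF assms])
  moreover have "query_perm n f ` dbasis n d \<subseteq> dbasis n d"
    using query_perm_in_dbasis[OF assms] by auto
  ultimately show ?thesis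
    by (intro bij_betw_byWitness[where f' = "query_perm n f"])
qed

section \<open>Forwarded queries as channels on pure states\<close>

lemma query_channel_forward:
  assumes f: "f \<in> bits (2 * n) \<rightarrow> bits n" and i: "i \<in> dbasis n d" and j: "j \<in> dbasis n d"
  shows "query_channel n d f (\<lambda>_. forward n) \<rho> i j = \<rho> (query_perm n f i) (query_perm n f j)"
proof -
  let ?B = "dbasis n d" and ?K = "query_kraus n f (\<lambda>_. forward n) 0 []"
  \<comment> \<open>The Kraus operator is a permutation matrix: a query evaluates the old amplitudes
    at the image of the label.\<close>
  have K: "?K i k = (if query_perm n f i = k then 1 else 0)" for i k
    by (auto simp: query_kraus_def query_perm_def circuit_entry_def forward_def split: prod.splits)
  \<comment> \<open>Forwarding uses exactly the query wires, so there are no ancillas and only one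
    Kraus operator.\<close>
  have width: "width n (forward n) = 3 * n"
    by (simp add: width_def forward_def)
  have "bits 0 = {[]}"
    by (auto simp: bits_def)
  then have "query_channel n d f (\<lambda>_. forward n) \<rho> i j = conjugate ?B ?K \<rho> i j"
    by (simp add: query_channel_def width)
  also have "\<dots> = (\<Sum>k\<in>?B. \<Sum>l\<in>?B. if query_perm n f j = l then
      (if query_perm n f i = k then \<rho> k l else 0) else 0)"
    unfolding conjugate_def K by (intro sum.cong) auto
  also have "\<dots> = \<rho> (query_perm n f i) (query_perm n f j)"
    using query_perm_in_dbasis[OF f i] query_perm_in_dbasis[OF f j] by (simp add: finite_dbasis)
  finally show ?thesis .
qed

text \<open>Purity is assumed only on \<open>B\<close>, since the formula for the query channel is
  available only for labels in the basis.\<close>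

lemma conjugate_pure:
  assumes "\<And>k l. k \<in> B \<Longrightarrow> l \<in> B \<Longrightarrow> \<rho> k l = \<psi> k * cnj (\<psi> l)"
  shows "conjugate B M \<rho> i j = mat_vec B M \<psi> i * cnj (mat_vec B M \<psi> j)"
proof -
  have "conjugate B M \<rho> i j = (\<Sum>k\<in>B. \<Sum>l\<in>B. (M i k * \<psi> k) * cnj (M j l * \<psi> l))"
    unfolding conjugate_def using assms by (intro sum.cong) (auto simp: mult_ac)
  also have "\<dots> = mat_vec B M \<psi> i * cnj (mat_vec B M \<psi> j)"
    by (simp add: mat_vec_def sum_product)
  finally show ?thesis .
qed

definition initial_vec :: "nat \<Rightarrow> dlabel \<Rightarrow> complex" where
  "initial_vec n = (\<lambda>i. if i = (Priv, replicate (3 * n) False, 0) then 1 else 0)"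

lemma vnorm_initial_vec:
  assumes "0 < d"
  shows "vnorm (dbasis n d) (initial_vec n) = 1"
proof -
  let ?z = "(Priv, replicate (3 * n) False, 0)"
  have "(\<Sum>i\<in>dbasis n d. (cmod (initial_vec n i))\<^sup>2) = (\<Sum>i\<in>dbasis n d. if i = ?z then 1 else 0)"
    by (intro sum.cong) (auto simp: initial_vec_def)
  also have "\<dots> = 1"
    using assms by (simp add: finite_dbasis) (simp add: dbasis_def bits_def)
  finally show ?thesis by (simp add: vnorm_def L2_set_def)
qed

lemma fold_query_channel_pure:
  assumes f: "f \<in> bits (2 * n) \<rightarrow> bits n" and "i \<in> dbasis n d" "j \<in> dbasis n d"
  shows "fold (\<lambda>U \<rho>. query_channel n d f (\<lambda>_. forward n) (conjugate (dbasis n d) U \<rho>)) Us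
      (initial_state n) i j
    = run (dbasis n d) (query_perm n f) Us (initial_vec n) i
      * cnj (run (dbasis n d) (query_perm n f) Us (initial_vec n) j)"
  using assms(2,3)
proof (induction Us arbitrary: i j rule: rev_induct)
  case Nil
  then show ?case
    by (simp add: run_def initial_state_def initial_vec_def Let_def)
next
  case (snoc U Us)
  then show ?case
    by (simp add: query_channel_forward[OF f] run_snoc conjugate_pure[OF snoc.IH])
qed

lemma accept_prob_forward:
  assumes "f \<in> bits (2 * n) \<rightarrow> bits n"
  shows "accept_prob n D f (\<lambda>_. forward n)
    = (vnorm (dbasis n (work_dim D) \<inter> accept D) (mat_vec (dbasis n (work_dim D)) (final D)
        (run (dbasis n (work_dim D)) (query_perm n f) (rounds D) (initial_vec n))))\<^sup>2"
  unfolding accept_prob_def final_state_def Let_def vnorm_power2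
  by (intro sum.cong refl, subst conjugate_pure, erule (1) fold_query_channel_pure[OF assms])
     (simp add: complex_norm_square[symmetric] del: of_real_power)


section \<open>Planting as reprogramming\<close>

text \<open>The length test keeps the default value of h on lists of other lengths, as needed for
  equality with \<open>planted_fun\<close>.\<close>

definition reprogram :: "nat \<Rightarrow> bool list \<Rightarrow> bfun \<Rightarrow> bfun" where
  "reprogram n s h = (\<lambda>z. if z \<in> bits (2 * n) \<and> drop n z = s then take n z else h z)"

lemma reprogram_in_bits:
  "h \<in> bits (2 * n) \<rightarrow> bits n \<Longrightarrow> reprogram n s h \<in> bits (2 * n) \<rightarrow> bits n"
  by (auto simp: reprogram_def bits_def)

text \<open>The class of a label is the last half of its 2n-bit input; reprogramming at s changes h
  only on inputs whose last half is s.\<close>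

lemma reprogrammed_oracle_query_perm:
  assumes h: "h \<in> bits (2 * n) \<rightarrow> bits n"
  shows "reprogrammed_oracle (dbasis n d) (bits n) (\<lambda>(b, q, w). drop n (take (2 * n) q))
    (query_perm n h) (\<lambda>s. query_perm n (reprogram n s h))"
proof (unfold_locales, goal_cases)
  case 4
  then show ?case by (rule bij_query_perm[OF h])
next
  case (5 s)
  then show ?case by (intro bij_query_perm reprogram_in_bits h)
next
  case (3 i)
  then show ?case by (auto simp: dbasis_def bits_def)
next
  case (8 s i)
  then show ?case by (auto simp: dbasis_def query_perm_def xor_query_def reprogram_def)
qed (simp_all add: finite_dbasis finite_bits, auto simp: query_perm_def dbasis_def take_xor_query)

lemma sum_accept_prob_diff_le:
  assumes h: "h \<in> bits (2 * n) \<rightarrow> bits n" and D: "is_distinguisher n D"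
  shows "(\<Sum>s\<in>bits n. \<bar>accept_prob n D (reprogram n s h) (\<lambda>_. forward n)
      - accept_prob n D h (\<lambda>_. forward n)\<bar>) \<le> 8 * (real (num_queries D))\<^sup>2"
proof -
  interpret reprogrammed_oracle "dbasis n (work_dim D)" "bits n"
    "\<lambda>(b, q, w). drop n (take (2 * n) q)" "query_perm n h" "\<lambda>s. query_perm n (reprogram n s h)"
    by (rule reprogrammed_oracle_query_perm[OF h])
  show ?thesis
    unfolding accept_prob_forward[OF h] accept_prob_forward[OF reprogram_in_bits[OF h]]
      num_queries_def
    using D by (intro sum_prob_diff_le) (auto simp: is_distinguisher_def vnorm_initial_vec)
qed

section \<open>The planted function as a reprogrammed uniform function\<close>

lemma uniform_fun_eq_Pi_pmf:
  "uniform_fun n = Pi_pmf (bits (2 * n)) [] (\<lambda>_. pmf_of_set (bits n))"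
  unfolding uniform_fun_def by (rule Pi_pmf_of_set[symmetric]) (auto simp: finite_bits bits_nonempty)

lemma set_uniform_fun: "set_pmf (uniform_fun n) = PiE_dflt (bits (2 * n)) [] (\<lambda>_. bits n)"
  by (simp add: uniform_fun_eq_Pi_pmf set_Pi_pmf finite_bits bits_nonempty o_def)

text \<open>Values are independent across inputs, so drawing all of them uniformly and then
  overwriting those at inputs ending in s yields the planted distribution.\<close>

lemma planted_fun_eq_reprogram:
  "planted_fun n
    = bind_pmf (pmf_of_set (bits n)) (\<lambda>s. map_pmf (reprogram n s) (uniform_fun n))"
proof -
  let ?u = "pmf_of_set (bits n)"
  have "Pi_pmf (bits (2 * n)) [] (\<lambda>z. if drop n z = s then return_pmf (take n z) else ?u)
      = map_pmf (reprogram n s) (uniform_fun n)" for s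
  proof -
    have "Pi_pmf (bits (2 * n)) [] (\<lambda>z. if drop n z = s then return_pmf (take n z) else ?u)
        = Pi_pmf (bits (2 * n)) []
            (\<lambda>z. ?u \<bind> (\<lambda>y. return_pmf (if drop n z = s then take n z else y)))"
      by (intro Pi_pmf_cong) (auto simp: bind_return_pmf')
    also have "\<dots> = uniform_fun n \<bind> (\<lambda>h. return_pmf
        (\<lambda>z. if z \<in> bits (2 * n) then if drop n z = s then take n z else h z else []))"
      unfolding uniform_fun_eq_Pi_pmf by (simp add: Pi_pmf_bind[where d' = "[]"] finite_bits)
    also have "\<dots> = uniform_fun n \<bind> (\<lambda>h. return_pmf (reprogram n s h))"
    proof (intro bind_pmf_cong refl arg_cong[where f = return_pmf] ext)
      fix h z assume "h \<in> set_pmf (uniform_fun n)"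
      then have "h \<in> PiE_dflt (bits (2 * n)) [] (\<lambda>_. bits n)"
        by (simp add: set_uniform_fun)
      then have "z \<notin> bits (2 * n) \<Longrightarrow> h z = []"
        by (auto simp: PiE_dflt_def)
      then show "(if z \<in> bits (2 * n) then if drop n z = s then take n z else h z else [])
          = reprogram n s h z"
        by (auto simp: reprogram_def)
    qed
    finally show ?thesis by (simp add: map_pmf_def)
  qed
  then show ?thesis by (simp add: planted_fun_def)
qed

text \<open>Both worlds are coupled through the same h: the bound is shown for each fixed h,
  averaged over s, and then integrated over h.\<close>

lemma distinguishing_advantage_le:
  assumes D: "is_distinguisher n D"
  shows "\<bar>real_prob planted_construction n D - ideal_prob random_construction forward n D\<bar>
    \<le> 8 * (real (num_queries D))\<^sup>2 / 2 ^ n"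
proof -
  let ?F = "\<lambda>f. accept_prob n D f (\<lambda>_. forward n)"
  let ?E = "measure_pmf.expectation (uniform_fun n)"
  have fin: "finite (set_pmf (uniform_fun n))"
    by (auto simp: set_uniform_fun finite_bits)
  note [simp] = integrable_measure_pmf_finite[OF fin]
  have const: "case_iface (forward n) (forward n) = (\<lambda>_. forward n)"
    by (auto split: iface.splits)
  have "real_prob planted_construction n D = (\<Sum>s\<in>bits n. ?E (\<lambda>h. ?F (reprogram n s h)) / 2 ^ n)"
    unfolding real_prob_def planted_construction_def
    by (simp add: const planted_fun_eq_reprogram pmf_expectation_bind_pmf_of_set finite_bits
        bits_nonempty fin card_bits divide_inverse_commute)
  also have "\<dots> = ?E (\<lambda>h. (\<Sum>s\<in>bits n. ?F (reprogram n s h)) / 2 ^ n)"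
    by (simp add: sum_divide_distrib)
  finally have real: "real_prob planted_construction n D = \<dots>" .
  have ideal: "ideal_prob random_construction forward n D = ?E ?F"
    by (simp add: ideal_prob_def random_construction_def const)
  have "\<bar>(\<Sum>s\<in>bits n. ?F (reprogram n s h)) / 2 ^ n - ?F h\<bar> \<le> 8 * (real (num_queries D))\<^sup>2 / 2 ^ n"
    if "h \<in> set_pmf (uniform_fun n)" for h
  proof -
    have h: "h \<in> bits (2 * n) \<rightarrow> bits n"
      using that by (auto simp: set_uniform_fun PiE_dflt_def)
    \<comment> \<open>The ideal probability is written as the average of \<open>2 ^ n\<close> equal
      terms, one for each s.\<close>
    have "(\<Sum>s\<in>bits n. ?F (reprogram n s h)) / 2 ^ n - ?F h
        = (\<Sum>s\<in>bits n. ?F (reprogram n s h) - ?F h) / 2 ^ n"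
      by (simp add: sum_subtractf card_bits field_simps)
    also have "\<bar>\<dots>\<bar> \<le> (\<Sum>s\<in>bits n. \<bar>?F (reprogram n s h) - ?F h\<bar>) / 2 ^ n"
      by (simp add: divide_right_mono)
    also have "\<dots> \<le> 8 * (real (num_queries D))\<^sup>2 / 2 ^ n"
      by (intro divide_right_mono sum_accept_prob_diff_le[OF h D]) simp
    finally show ?thesis .
  qed
  then have "?E (\<lambda>h. \<bar>(\<Sum>s\<in>bits n. ?F (reprogram n s h)) / 2 ^ n - ?F h\<bar>)
      \<le> ?E (\<lambda>_. 8 * (real (num_queries D))\<^sup>2 / 2 ^ n)"
    by (intro integral_mono_AE) (auto simp: AE_measure_pmf_iff)
  moreover have "\<bar>?E (\<lambda>h. (\<Sum>s\<in>bits n. ?F (reprogram n s h)) / 2 ^ n - ?F h)\<bar>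
      \<le> ?E (\<lambda>h. \<bar>(\<Sum>s\<in>bits n. ?F (reprogram n s h)) / 2 ^ n - ?F h\<bar>)"
    by (rule integral_abs_bound)
  ultimately show ?thesis
    unfolding real ideal by simp
qed

section \<open>Efficiency of the simulator and the final bound\<close>

lemma efficient_forward: "efficient forward"
proof -
  have "\<exists>t\<le>n ^ 1 + 1. \<exists>pc m.
      (machine_step [EmitQuery 1] ^^ t) (0, (\<lambda>_. 0)(0 := n), []) = (pc, m, forward n)
      \<and> halted [EmitQuery 1] (pc, m, forward n)" for n
    \<comment> \<open>Register 1 initially holds 0, so the single instruction emits
      \<open>Query 0\<close>, and one step moves the program counter past the end.\<close>
    by (rule exI[of _ 1]) (simp add: machine_step_def halted_def forward_def)
  moreover have "\<forall>g\<in>set (forward n). wf_gate g" for n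
    by (simp add: forward_def)
  ultimately show ?thesis
    unfolding efficient_def by blast
qed

theorem theorem3:
  shows "\<exists>\<epsilon> :: nat \<Rightarrow> nat \<Rightarrow> real.
    (\<exists>c. \<forall>T n. \<bar>\<epsilon> T n\<bar> \<le> c * (real T)\<^sup>2 / 2 ^ n) \<and>
    (\<forall>T :: nat \<Rightarrow> nat.
       strong_quantum_statistical_reset_indifferentiable
         planted_construction random_construction T (\<lambda>n. \<epsilon> (T n) n))"
proof (intro exI[of _ "\<lambda>T n. 8 * (real T)\<^sup>2 / 2 ^ n"] conjI exI[of _ 8] allI)
  fix T :: "nat \<Rightarrow> nat"
  have "\<bar>real_prob planted_construction n D - ideal_prob random_construction forward n D\<bar>
      \<le> 8 * (real (T n))\<^sup>2 / 2 ^ n" if "is_distinguisher n D" "num_queries D \<le> T n" for n D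
  proof -
    \<comment> \<open>The bound is monotone in the number of queries, so it also covers
      distinguishers that make fewer than \<open>T n\<close>.\<close>
    have "8 * (real (num_queries D))\<^sup>2 / 2 ^ n \<le> 8 * (real (T n))\<^sup>2 / 2 ^ n"
      using that(2) by (intro divide_right_mono mult_left_mono power_mono) auto
    with distinguishing_advantage_le[OF that(1)] show ?thesis by linarith
  qed
  then show "strong_quantum_statistical_reset_indifferentiable planted_construction
      random_construction T (\<lambda>n. 8 * (real (T n))\<^sup>2 / 2 ^ n)"
    unfolding strong_quantum_statistical_reset_indifferentiable_def
    using efficient_forward by blast
qed simp

end
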